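(* Let $A_5 = \begin{bmatrix} 0 & 3 \\ 2 & 1 \end{bmatrix}$. (1) For all integers $m \geq 1$ and $t \geq 0$: if $5t+2 < 5m/2$, then the generalized Petersen graph $GP(5m, 5t+2)$ has a perfect 2-coloring with the matrix $A_5$; and if $5t+3 < 5m/2$, then the generalized Petersen graph $GP(5m,5t+3)$ has a perfect 2-coloring with the matrix $A_5$. (2) For all integers $n \geq 3$ and $1 \leq k < n/2$ with $5 \nmid n$, the generalized Petersen graph $GP(n,k)$ has no perfect 2-coloring with the matrix $A_5$.
   Context: For integers $n \geq 3$ and $1 \leq k < n/2$, the generalized Petersen graph $GP(n,k)$ is the cubic graph with vertex set $\{a_i, b_i : 0 \leq i \leq n-1\}$ and edge set $\{a_i a_{i+1},\ a_i b_i,\ b_i b_{i+k} : 0 \leq i \leq n-1\}$, with indices taken modulo $n$. For a graph $G$ and an integer $m$, a mapping $T: V(G) \to \{1,\dots,m\}$ is called a perfect $m$-coloring with matrix $A = (a_{ij})_{i,j \in \{1,\dots,m\}}$ if $T$ is surjective and for all $i,j$, every vertex of color $i$ has exactly $a_{ij}$ neighbors of color $j$. (Perfect 2-colorings are considered up to renaming the two colors.) *)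

theory Defs
  imports "HOL-Analysis.Cartesian_Space" "Graph_Theory.Pair_Digraph"
begin

text \<open>Undirected graphs are symmetric digraphs, as everywhere in \<open>Graph_Theory\<close>.
  \<open>Outer i\<close> is the vertex $a_i$ and \<open>Inner i\<close> is $b_i$.\<close>

datatype gp_vertex = Outer nat | Inner nat

definition gp_edges :: "nat \<Rightarrow> nat \<Rightarrow> (gp_vertex \<times> gp_vertex) set" where
  "gp_edges n k =
     {(Outer i, Outer ((i + 1) mod n)) | i. i < n} \<union>
     {(Outer i, Inner i) | i. i < n} \<union>
     {(Inner i, Inner ((i + k) mod n)) | i. i < n}"

definition generalized_petersen :: "nat \<Rightarrow> nat \<Rightarrow> gp_vertex pair_pre_digraph" where
  "generalized_petersen n k =
     \<lparr> pverts = {Outer i | i. i < n} \<union> {Inner i | i. i < n},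
       parcs = gp_edges n k \<union> (gp_edges n k)\<inverse> \<rparr>"

text \<open>The colours $1, \dots, m$ are the elements of the finite index type \<open>'m\<close>, so an
  $m \times m$ matrix is a \<open>nat^'m^'m\<close>. For two colours \<open>'m\<close> is the numeral type \<open>2\<close>, with
  elements \<open>1\<close> and \<open>2\<close>. The values of \<open>T\<close> outside \<open>verts G\<close> are irrelevant.\<close>

definition perfect_coloring ::
    "('a, 'b) pre_digraph \<Rightarrow> nat ^ 'm ^ 'm \<Rightarrow> ('a \<Rightarrow> 'm::finite) \<Rightarrow> bool" where
  "perfect_coloring G A T \<longleftrightarrow>
     T ` verts G = UNIV \<and>
     (\<forall>i j. \<forall>u \<in> verts G. T u = i \<longrightarrow>
        card {v \<in> verts G. u \<rightarrow>\<^bsub>G\<^esub> v \<and> T v = j} = A $ i $ j)"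

definition has_perfect_coloring :: "('a, 'b) pre_digraph \<Rightarrow> nat ^ 'm ^ 'm::finite \<Rightarrow> bool" where
  "has_perfect_coloring G A \<longleftrightarrow> (\<exists>T. perfect_coloring G A T)"

definition A5 :: "nat ^ 2 ^ 2" where
  "A5 = vector [vector [0, 3],
                vector [2, 1]]"

lemma A5_entries: "A5 $ 1 $ 1 = 0" "A5 $ 1 $ 2 = 3" "A5 $ 2 $ 1 = 2" "A5 $ 2 $ 2 = 1"
  by (simp_all add: A5_def)

lemma gp_shift_mod:
  fixes n k i :: nat
  assumes "i < n" "k < n"
  shows "(i + k) mod n = (if i + k < n then i + k else i + k - n)"
  using assms by (auto simp: mod_if)

lemma gp_Suc_mod:
  fixes n i :: nat
  assumes "i < n"
  shows "Suc i mod n = (if Suc i < n then Suc i else 0)"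
  using assms by (auto simp: mod_if)

lemma gp_pair_graph:
  assumes "n \<ge> 3" "1 \<le> k" "2 * k < n"
  shows "pair_graph (generalized_petersen n k)"
proof -
  let ?V = "pverts (generalized_petersen n k)" and ?E = "parcs (generalized_petersen n k)"
  have sub: "?E \<subseteq> ?V \<times> ?V"
    using assms by (auto simp: generalized_petersen_def gp_edges_def)
  have fin: "finite ?V" by (auto simp: generalized_petersen_def)
  have finE: "finite ?E" using finite_subset[OF sub] fin by blast
  have sym: "sym ?E" by (auto simp: generalized_petersen_def sym_def)
  have irr: "fst e \<noteq> snd e" if "e \<in> ?E" for e
    using that assms
    by (auto simp: generalized_petersen_def gp_edges_def gp_shift_mod gp_Suc_mod split: if_splits)
  show ?thesis
    by unfold_locales (use sub fin finE sym irr in \<open>auto simp: symmetric_def\<close>)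
qed

lemma gp_cubic:
  assumes "n \<ge> 3" "1 \<le> k" "2 * k < n" and u: "u \<in> pverts (generalized_petersen n k)"
  shows "card {v. u \<rightarrow>\<^bsub>with_proj (generalized_petersen n k)\<^esub> v} = 3"
proof -
  let ?p = "\<lambda>i d. if d \<le> i then i - d else i + n - d"
  have pre: "i = (j + d) mod n \<and> j < n \<longleftrightarrow> j = ?p i d" if "i < n" "d < n" for i j d
    using that by (auto simp: gp_shift_mod split: if_splits)
  show ?thesis
  proof (cases u)
    case (Outer i)
    with u have i: "i < n" by (auto simp: generalized_petersen_def)
    have "{v. u \<rightarrow>\<^bsub>with_proj (generalized_petersen n k)\<^esub> v} =
        {Outer ((i + 1) mod n), Outer (?p i 1), Inner i}"
      using i assms pre[OF i, of 1] Outer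
      by (fastforce simp: generalized_petersen_def gp_edges_def)
    then show ?thesis
      using i assms by (auto simp: gp_Suc_mod card_insert_if)
  next
    case (Inner i)
    with u have i: "i < n" by (auto simp: generalized_petersen_def)
    have "{v. u \<rightarrow>\<^bsub>with_proj (generalized_petersen n k)\<^esub> v} =
        {Inner ((i + k) mod n), Inner (?p i k), Outer i}"
      using i assms pre[OF i, of k] Inner
      by (fastforce simp: generalized_petersen_def gp_edges_def)
    then show ?thesis
      using i assms by (auto simp: gp_shift_mod card_insert_if)
  qed
qed

end

theory Submission
  imports Defs
begin

text \<open>Call the vertices of colour \<open>1\<close> white and the others black. A colouring with matrix
  \<open>A5\<close> is an independent white set in which every black vertex has exactly two white
  neighbours.

  The divisibility condition comes from counting the edges between the two classes from either
  side: three leave each white vertex and two leave each black one, so $3|W| = 2|B|$. Since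
  $|W| + |B| = 2n$, this gives $5|W| = 4n$, and hence $5$ divides $n$
  (\<open>perfect_coloring_double_count\<close>, \<open>A5_coloring_imp_5_dvd\<close>).

  For existence, note that reducing indices modulo \<open>5\<close> maps $GP(5m, k)$ with
  $k \equiv \pm 2$ onto the Petersen graph $GP(5, 2)$, and maps the neighbours of each vertex
  bijectively to the neighbours of its image. A suitable colouring of the Petersen graph therefore
  lifts. One is obtained from a maximum independent set, such as $\{a_0, a_2, b_3, b_4\}$: its
  complement induces a perfect matching, so each of the six remaining vertices has one black and
  two white neighbours (\<open>A5_coloring_lifts\<close>).\<close>

section \<open>Counting edges between colour classes\<close>

text \<open>For \<open>i \<noteq> j\<close>, both sides count the edges between the colour classes of \<open>i\<close> and \<open>j\<close>,
  seen from one class or the other.\<close>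

lemma perfect_coloring_double_count:
  assumes T: "perfect_coloring G A T" and fin: "finite (verts G)" and sym: "symmetric G"
  shows "A $ i $ j * card {u \<in> verts G. T u = i} = A $ j $ i * card {v \<in> verts G. T v = j}"
proof -
  let ?V = "\<lambda>c. {u \<in> verts G. T u = c}"
  have row: "card {v \<in> ?V d. u \<rightarrow>\<^bsub>G\<^esub> v} = A $ c $ d" if "u \<in> ?V c" for u c d
  proof -
    have "{v \<in> ?V d. u \<rightarrow>\<^bsub>G\<^esub> v} = {v \<in> verts G. u \<rightarrow>\<^bsub>G\<^esub> v \<and> T v = d}" by auto
    then show ?thesis using T that by (auto simp: perfect_coloring_def)
  qed
  have col: "card {u \<in> ?V i. u \<rightarrow>\<^bsub>G\<^esub> v} = A $ j $ i" if "v \<in> ?V j" for v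
  proof -
    have "{u \<in> ?V i. u \<rightarrow>\<^bsub>G\<^esub> v} = {u \<in> ?V i. v \<rightarrow>\<^bsub>G\<^esub> u}"
      using sym by (auto simp: symmetric_def dest: symD)
    then show ?thesis using row[OF that] by simp
  qed
  have "(\<Sum>u\<in>?V i. card {v \<in> ?V j. u \<rightarrow>\<^bsub>G\<^esub> v}) = (\<Sum>v\<in>?V j. A $ j $ i)"
    using fin col by (intro sum_multicount_gen) auto
  then show ?thesis using row by (simp add: mult.commute)
qed

lemma finite_verts_gp: "finite (pverts (generalized_petersen n k))"
  by (simp add: generalized_petersen_def)

lemma card_verts_gp: "card (pverts (generalized_petersen n k)) = 2 * n"
proof -
  have "pverts (generalized_petersen n k) = Outer ` {..<n} \<union> Inner ` {..<n}"
    by (auto simp: generalized_petersen_def)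
  moreover have "card (Outer ` {..<n}) = n" "card (Inner ` {..<n}) = n"
    by (simp_all add: card_image inj_on_def)
  moreover have "Outer ` {..<n} \<inter> Inner ` {..<n} = {}" by auto
  ultimately show ?thesis
    by (simp add: card_Un_disjoint)
qed

lemma symmetric_gp: "symmetric (with_proj (generalized_petersen n k))"
  by (auto simp: symmetric_def generalized_petersen_def sym_def)

lemma A5_coloring_imp_5_dvd:
  assumes "has_perfect_coloring (with_proj (generalized_petersen n k)) A5"
  shows "5 dvd n"
proof -
  let ?V = "pverts (generalized_petersen n k)"
  obtain T where T: "perfect_coloring (with_proj (generalized_petersen n k)) A5 T"
    using assms by (auto simp: has_perfect_coloring_def)
  let ?W = "{u \<in> ?V. T u = 1}" and ?B = "{u \<in> ?V. T u = 2}"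
  have edges: "3 * card ?W = 2 * card ?B"
    using perfect_coloring_double_count[OF T _ symmetric_gp, of 1 2]
    by (simp add: A5_entries finite_verts_gp)
  have "?V = ?W \<union> ?B" using exhaust_2 by blast
  moreover have "card (?W \<union> ?B) = card ?W + card ?B"
    by (rule card_Un_disjoint) (auto simp: finite_verts_gp)
  ultimately have "card ?W + card ?B = 2 * n" by (simp add: card_verts_gp)
  with edges have "5 * card ?W = 4 * n" by simp
  then show ?thesis by presburger
qed

section \<open>Lifting a colouring of the Petersen graph\<close>

lemma gp_unshift_mod:
  fixes n i d :: nat
  assumes "i < n" "d < n"
  shows "(i + (n - d)) mod n = (if d \<le> i then i - d else i + n - d)"
proof (cases "d \<le> i")
  case True
  then have "i + (n - d) = i - d + n" using assms by simp
  then show ?thesis using True assms by (simp only: mod_add_self2) simp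
qed (use assms in simp)

text \<open>Predecessors are written with a single reduction modulo \<open>n\<close> and no case distinction, so
  that their residues modulo \<open>5\<close> can be read off when \<open>5\<close> divides \<open>n\<close>.\<close>

lemma gp_shift_inverse:
  fixes n i j d :: nat
  assumes "i < n" "d < n"
  shows "i = (j + d) mod n \<and> j < n \<longleftrightarrow> j = (i + (n - d)) mod n"
  unfolding gp_unshift_mod[OF assms] using assms
  by (auto simp: gp_shift_mod split: if_splits)

lemma gp_neighbours_Outer:
  assumes "n \<ge> 3" "i < n"
  shows "{v. Outer i \<rightarrow>\<^bsub>with_proj (generalized_petersen n k)\<^esub> v} =
    {Outer ((i + 1) mod n), Outer ((i + (n - 1)) mod n), Inner i}"
  using assms gp_shift_inverse[OF assms(2), of 1]
  by (fastforce simp: generalized_petersen_def gp_edges_def)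

lemma gp_neighbours_Inner:
  assumes "k < n" "i < n"
  shows "{v. Inner i \<rightarrow>\<^bsub>with_proj (generalized_petersen n k)\<^esub> v} =
    {Inner ((i + k) mod n), Inner ((i + (n - k)) mod n), Outer i}"
  using assms gp_shift_inverse[OF assms(2), of k]
  by (fastforce simp: generalized_petersen_def gp_edges_def)

lemma gp_shifts_distinct:
  fixes n i d :: nat
  assumes "i < n" "1 \<le> d" "2 * d < n"
  shows "(i + d) mod n \<noteq> (i + (n - d)) mod n"
proof -
  have "d < n" using assms by simp
  then show ?thesis
    unfolding gp_shift_mod[OF assms(1) \<open>d < n\<close>] gp_unshift_mod[OF assms(1) \<open>d < n\<close>]
    using assms by (auto split: if_splits)
qed

text \<open>Since $-d \equiv 4d$ modulo \<open>5\<close>, the index of a predecessor can be rewritten without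
  truncated subtraction.\<close>

lemma unshift_mod_5:
  fixes n i d :: nat
  assumes "5 dvd n" "d \<le> n"
  shows "(i + (n - d)) mod 5 = (i + 4 * d) mod 5"
proof -
  have "(i + (n - d)) mod 5 = (i + (n - d) + 5 * d) mod 5" by simp
  also have "i + (n - d) + 5 * d = i + 4 * d + n" using assms(2) by simp
  also have "\<dots> mod 5 = (i + 4 * d) mod 5" using assms(1) by (auto elim!: dvdE)
  finally show ?thesis .
qed

lemma residues_mod_5:
  fixes i :: nat
  shows "i mod 5 = 0 \<and> (i + 1) mod 5 = 1 \<and> (i + 2) mod 5 = 2 \<and> (i + 3) mod 5 = 3 \<and> (i + 4) mod 5 = 4 \<or>
    i mod 5 = 1 \<and> (i + 1) mod 5 = 2 \<and> (i + 2) mod 5 = 3 \<and> (i + 3) mod 5 = 4 \<and> (i + 4) mod 5 = 0 \<or>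
    i mod 5 = 2 \<and> (i + 1) mod 5 = 3 \<and> (i + 2) mod 5 = 4 \<and> (i + 3) mod 5 = 0 \<and> (i + 4) mod 5 = 1 \<or>
    i mod 5 = 3 \<and> (i + 1) mod 5 = 4 \<and> (i + 2) mod 5 = 0 \<and> (i + 3) mod 5 = 1 \<and> (i + 4) mod 5 = 2 \<or>
    i mod 5 = 4 \<and> (i + 1) mod 5 = 0 \<and> (i + 2) mod 5 = 1 \<and> (i + 3) mod 5 = 2 \<and> (i + 4) mod 5 = 3"
proof -
  have "(i + c) mod 5 = (i mod 5 + c) mod 5" for c
    by (simp only: mod_add_left_eq)
  note shift = this[of 1] this[of 2] this[of 3] this[of 4]
  have "i mod 5 = 0 \<or> i mod 5 = 1 \<or> i mod 5 = 2 \<or> i mod 5 = 3 \<or> i mod 5 = 4"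
    by presburger
  then show ?thesis unfolding shift by (elim disjE) simp_all
qed

lemma card_filter_three:
  assumes "x \<noteq> y" "x \<noteq> z" "y \<noteq> z"
  shows "card {v \<in> {x, y, z}. P v} = of_bool (P x) + of_bool (P y) + of_bool (P z)"
proof -
  have "card {v \<in> {x, y, z}. P v} = (\<Sum>v\<in>{x, y, z}. of_bool (P v))"
    by (simp add: sum.If_cases Int_def flip: of_bool_def)
  then show ?thesis using assms by simp
qed

text \<open>Colour \<open>1\<close> is the preimage of the maximum independent set $\{a_0, a_2, b_3, b_4\}$ of
  $GP(5, 2)$ under reduction of indices modulo \<open>5\<close>.\<close>

definition petersen_coloring :: "gp_vertex \<Rightarrow> 2" where
  "petersen_coloring v = (case v of
     Outer i \<Rightarrow> if i mod 5 \<in> {0, 2} then 1 else 2 |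
     Inner i \<Rightarrow> if i mod 5 \<in> {3, 4} then 1 else 2)"

text \<open>The three neighbours of a vertex have distinct images in the Petersen graph, namely the
  three neighbours of its image. The rows of \<open>A5\<close> therefore only need to be checked at the ten
  vertices of $GP(5, 2)$, one outer and one inner vertex for each residue.\<close>

lemma A5_coloring_lifts:
  assumes n: "5 dvd n" and k: "1 \<le> k" "2 * k < n" "k mod 5 = 2 \<or> k mod 5 = 3"
  shows "has_perfect_coloring (with_proj (generalized_petersen n k)) A5"
proof -
  let ?G = "with_proj (generalized_petersen n k)" and ?T = petersen_coloring
  have n5: "n \<ge> 5" using n k(2) by (auto elim!: dvdE)
  \<comment> \<open>Since \<open>5\<close> divides \<open>n\<close>, reduction modulo \<open>n\<close> does not change a residue modulo \<open>5\<close>.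
    The colours around a vertex thus depend only on the residue of its index.\<close>
  have count: "card {v \<in> verts ?G. u \<rightarrow>\<^bsub>?G\<^esub> v \<and> ?T v = j} = A5 $ ?T u $ j"
    if u: "u \<in> verts ?G" for u j
  proof -
    have nbrs: "{v \<in> verts ?G. u \<rightarrow>\<^bsub>?G\<^esub> v \<and> ?T v = j} = {v \<in> {v. u \<rightarrow>\<^bsub>?G\<^esub> v}. ?T v = j}"
      using n5 by (auto simp: generalized_petersen_def gp_edges_def)
    have j: "j = 1 \<or> j = 2" by (rule exhaust_2)
    have red: "x mod n mod 5 = x mod 5" for x using n by (rule mod_mod_cancel)
    show ?thesis
    proof (cases u)
      case (Outer i)
      with u have i: "i < n" by (auto simp: generalized_petersen_def)
      have prev: "(i + (n - 1)) mod 5 = (i + 4) mod 5"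
        using unshift_mod_5[OF n, of 1 i] n5 by simp
      have "n \<ge> 3" using n5 by simp
      note nbhd = gp_neighbours_Outer[OF this i, of k]
      have card_nbrs: "card {v \<in> {v. u \<rightarrow>\<^bsub>?G\<^esub> v}. ?T v = j} =
          of_bool (?T (Outer ((i + 1) mod n)) = j)
          + of_bool (?T (Outer ((i + (n - 1)) mod n)) = j) + of_bool (?T (Inner i) = j)"
        unfolding Outer nbhd
        by (rule card_filter_three) (use gp_shifts_distinct[OF i, of 1] n5 in simp_all)
      show ?thesis
        unfolding nbrs card_nbrs using j residues_mod_5[of i] prev
        by (elim disjE) (simp_all add: petersen_coloring_def Outer red A5_entries)
    next
      case (Inner i)
      with u have i: "i < n" by (auto simp: generalized_petersen_def)
      have "k < n" using k(2) by simp
      note nbhd = gp_neighbours_Inner[OF this i]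
      have card_nbrs: "card {v \<in> {v. u \<rightarrow>\<^bsub>?G\<^esub> v}. ?T v = j} =
          of_bool (?T (Inner ((i + k) mod n)) = j)
          + of_bool (?T (Inner ((i + (n - k)) mod n)) = j) + of_bool (?T (Outer i) = j)"
        unfolding Inner nbhd
        by (rule card_filter_three) (use gp_shifts_distinct[OF i k(1,2)] in simp_all)
      \<comment> \<open>For both residues of \<open>k\<close> the two inner neighbours have indices \<open>i + 2\<close> and \<open>i + 3\<close>
        modulo \<open>5\<close>, in one order or the other.\<close>
      have "(i + k) mod 5 = (i + 2) mod 5 \<and> (i + (n - k)) mod 5 = (i + 3) mod 5 \<or>
        (i + k) mod 5 = (i + 3) mod 5 \<and> (i + (n - k)) mod 5 = (i + 2) mod 5"
      proof -
        have fwd: "(i + k) mod 5 = (i + k mod 5) mod 5"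
          by (simp only: mod_add_right_eq)
        have bwd: "(i + (n - k)) mod 5 = (i + 4 * (k mod 5)) mod 5"
        proof -
          have "(i + (n - k)) mod 5 = (i + 4 * k) mod 5"
            by (rule unshift_mod_5[OF n]) (use k(2) in simp)
          also have "\<dots> = (i + 4 * (k mod 5)) mod 5"
            by (rule mod_add_cong[OF refl mod_mult_right_eq[symmetric]])
          finally show ?thesis .
        qed
        from k(3) show ?thesis
        proof
          assume k2: "k mod 5 = 2"
          have "(i + 4 * 2) mod 5 = (i + 3) mod 5" by presburger
          then show ?thesis unfolding fwd bwd k2 by blast
        next
          assume k3: "k mod 5 = 3"
          have "(i + 4 * 3) mod 5 = (i + 2) mod 5" by presburger
          then show ?thesis unfolding fwd bwd k3 by blast
        qed
      qed
      then show ?thesis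
        unfolding nbrs card_nbrs using j residues_mod_5[of i]
        by (elim disjE) (simp_all add: petersen_coloring_def Inner red A5_entries)
    qed
  qed
  have "Outer 0 \<in> verts ?G" "Outer 1 \<in> verts ?G"
    using n5 by (auto simp: generalized_petersen_def)
  moreover have "?T (Outer 0) = 1" "?T (Outer 1) = 2"
    by (simp_all add: petersen_coloring_def)
  ultimately have "1 \<in> ?T ` verts ?G" "2 \<in> ?T ` verts ?G"
    by (metis imageI)+
  then have "?T ` verts ?G = UNIV" by (metis UNIV_eq_I exhaust_2)
  with count have "perfect_coloring ?G A5 ?T" by (auto simp: perfect_coloring_def)
  then show ?thesis by (auto simp: has_perfect_coloring_def)
qed

theorem theorem3p5:
  shows "(\<forall>m t :: nat. m \<ge> 1 \<longrightarrow>
            (real (5 * t + 2) < real (5 * m) / 2 \<longrightarrow>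
               has_perfect_coloring (with_proj (generalized_petersen (5 * m) (5 * t + 2))) A5) \<and>
            (real (5 * t + 3) < real (5 * m) / 2 \<longrightarrow>
               has_perfect_coloring (with_proj (generalized_petersen (5 * m) (5 * t + 3))) A5)) \<and>
         (\<forall>n k :: nat. n \<ge> 3 \<longrightarrow> 1 \<le> k \<longrightarrow> real k < real n / 2 \<longrightarrow> \<not> 5 dvd n \<longrightarrow>
            \<not> has_perfect_coloring (with_proj (generalized_petersen n k)) A5)"
proof -
  have "has_perfect_coloring (with_proj (generalized_petersen (5 * m) (5 * t + r))) A5"
    if "r = 2 \<or> r = 3" "real (5 * t + r) < real (5 * m) / 2" for m t r
  proof (rule A5_coloring_lifts)
    have "real (2 * (5 * t + r)) < real (5 * m)" using that(2) by simp
    then show "2 * (5 * t + r) < 5 * m" by (simp only: of_nat_less_iff)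
  qed (use that(1) in auto)
  then show ?thesis using A5_coloring_imp_5_dvd by blast
qed

end
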